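(* Let $A$, $B$ and $Y$ be $k$-spaces, with $B$ weak Hausdorff, and let $q:Y\to B$ be a Hurewicz fibration with a section $t:B\to Y$ that is a closed cofibration. If $f:A\to B$ is a continuous map, then the projection $f^{\ast}q:Y\sqcap A\to A$ is a Hurewicz fibration, and its section $\sigma:A\to Y\sqcap A$, $\sigma(a)=(t(f(a)),a)$, is a closed cofibration.
   Context: A topological space $X$ is a $k$-space if it has the final topology relative to all continuous maps $C\to X$ from compact Hausdorff spaces $C$; $kX$ denotes the set $X$ retopologized with this final topology. All spaces are $k$-spaces and all constructions are $k$-ified: $X\times Y$ means $k$ of the usual product, and the pullback $Y\sqcap A=\{(y,a): q(y)=f(a)\}$ has the $k$-ification of the subspace topology; $f^{\ast}q(y,a)=a$. $B$ is weak Hausdorff if its diagonal is closed in the ($k$-ified) product $B\times B$. A Hurewicz fibration is a map of $k$-spaces with the covering homotopy property relative to all $k$-spaces. A closed cofibration is a map that is a homeomorphism onto a closed subspace and has the homotopy extension property with respect to all ($k$-)spaces. *)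

theory Defs
  imports "HOL-Analysis.Analysis"
begin

section \<open>k-spaces\<close>

text \<open>
  The k-ification of a space on \<open>'a\<close> is the final topology for \<^emph>\<open>all\<close> continuous maps out of compact
  Hausdorff spaces. HOL cannot quantify over types inside a definition, so the test spaces are
  taken on one type that is large enough: the fact \<open>kify_test\<close> below proves that a set passing
  these tests passes those by compact Hausdorff spaces on an arbitrary type.

  The constant \<^const>\<open>k_space\<close> of HOL-Analysis tests with compact subsets instead, which is a
  different notion for non-Hausdorff spaces.
\<close>

type_synonym 'a ktest = "(nat + 'a) set set set set"

definition kify :: "'a topology \<Rightarrow> 'a topology" where
  "kify X = topology (\<lambda>U. U \<subseteq> topspace X \<and>
     (\<forall>(C :: 'a ktest topology) g.
        compact_space C \<and> Hausdorff_space C \<and> continuous_map C X g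
          \<longrightarrow> openin C {x \<in> topspace C. g x \<in> U}))"

definition kspace :: "'a topology \<Rightarrow> bool" where
  "kspace X \<longleftrightarrow> kify X = X"

lemma openin_kify:
  fixes X :: "'a topology"
  shows "openin (kify X) U \<longleftrightarrow> U \<subseteq> topspace X \<and>
     (\<forall>(C :: 'a ktest topology) g.
        compact_space C \<and> Hausdorff_space C \<and> continuous_map C X g
          \<longrightarrow> openin C {x \<in> topspace C. g x \<in> U})"
proof -
  let ?P = "\<lambda>U. U \<subseteq> topspace X \<and>
     (\<forall>(C :: 'a ktest topology) g.
        compact_space C \<and> Hausdorff_space C \<and> continuous_map C X g
          \<longrightarrow> openin C {x \<in> topspace C. g x \<in> U})"
  have "istopology ?P"
    unfolding istopology_def
  proof (intro conjI allI impI)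
    fix S T assume S: "?P S" and T: "?P T"
    show "S \<inter> T \<subseteq> topspace X" using S by blast
    fix C :: "'a ktest topology" and g
    assume *: "compact_space C \<and> Hausdorff_space C \<and> continuous_map C X g"
    have "{x \<in> topspace C. g x \<in> S \<inter> T} = {x \<in> topspace C. g x \<in> S} \<inter> {x \<in> topspace C. g x \<in> T}"
      by auto
    then show "openin C {x \<in> topspace C. g x \<in> S \<inter> T}"
      using S T * by (simp add: openin_Int)
  next
    fix \<K> assume K: "\<forall>K\<in>\<K>. ?P K"
    show "\<Union>\<K> \<subseteq> topspace X" using K by blast
    fix C :: "'a ktest topology" and g
    assume *: "compact_space C \<and> Hausdorff_space C \<and> continuous_map C X g"
    have "{x \<in> topspace C. g x \<in> \<Union>\<K>} = \<Union> ((\<lambda>K. {x \<in> topspace C. g x \<in> K}) ` \<K>)"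
      by auto
    moreover have "openin C \<dots>"
      using K * by (intro openin_Union) auto
    ultimately show "openin C {x \<in> topspace C. g x \<in> \<Union>\<K>}"
      by simp
  qed
  then show ?thesis
    by (simp add: kify_def)
qed

lemma openin_imp_openin_kify: "openin X U \<Longrightarrow> openin (kify X) U"
  unfolding openin_kify by (auto simp: openin_subset openin_continuous_map_preimage)

lemma topspace_kify [simp]: "topspace (kify X) = topspace X"
  by (metis openin_imp_openin_kify openin_kify openin_subset openin_topspace subset_antisym)

lemma kify_test_transport:
  fixes X :: "'a topology" and C :: "'c topology" and j :: "'c \<Rightarrow> 'a ktest"
  assumes j: "inj_on j (topspace C)"
    and C: "compact_space C" "Hausdorff_space C" and g: "continuous_map C X g"
    and U: "openin (kify X) U"
  shows "openin C {x \<in> topspace C. g x \<in> U}"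
proof -
  define i where "i = inv_into (topspace C) j"
  define C' where "C' = pullback_topology (j ` topspace C) i C"
  have ij: "i (j x) = x" if "x \<in> topspace C" for x
    using j that by (simp add: i_def)
  have top: "topspace C' = j ` topspace C"
    using ij by (auto simp: C'_def topspace_pullback_topology)
  have hom: "homeomorphic_maps C C' j i"
    unfolding homeomorphic_maps_def
  proof (intro conjI)
    show "continuous_map C C' j"
      unfolding continuous_map_def
    proof (intro conjI allI impI)
      show "j \<in> topspace C \<rightarrow> topspace C'" using top by auto
      fix W assume "openin C' W"
      then obtain V where V: "openin C V" "W = i -` V \<inter> j ` topspace C"
        by (auto simp: C'_def openin_pullback_topology)
      then have "{x \<in> topspace C. j x \<in> W} = V"
        using ij openin_subset[OF V(1)] by auto
      then show "openin C {x \<in> topspace C. j x \<in> W}" using V by simp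
    qed
    show "continuous_map C' C i"
      using continuous_map_pullback[OF continuous_map_id, of _ i C] by (simp add: C'_def)
  qed (use ij top in auto)
  then have hs: "C homeomorphic_space C'"
    by (auto simp: homeomorphic_space_def)
  have "compact_space C'" "Hausdorff_space C'"
    using C hs homeomorphic_compact_space homeomorphic_Hausdorff_space by blast+
  moreover have "continuous_map C' X (g \<circ> i)"
    using hom g by (auto simp: homeomorphic_maps_def intro: continuous_map_compose)
  ultimately have "openin C' {x \<in> topspace C'. (g \<circ> i) x \<in> U}"
    using U unfolding openin_kify by blast
  then have "openin C {x \<in> topspace C. j x \<in> {x \<in> topspace C'. (g \<circ> i) x \<in> U}}"
    using hom unfolding homeomorphic_maps_def by (blast intro: openin_continuous_map_preimage)
  moreover have "{x \<in> topspace C. j x \<in> {x \<in> topspace C'. (g \<circ> i) x \<in> U}} = {x \<in> topspace C. g x \<in> U}"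
    using ij top by auto
  ultimately show ?thesis by simp
qed

theorem kify_test:
  fixes X :: "'a topology" and C :: "'c topology"
  assumes C: "compact_space C" "Hausdorff_space C" and g: "continuous_map C X g"
    and U: "openin (kify X) U"
  shows "openin C {x \<in> topspace C. g x \<in> U}"
proof (rule ccontr)
  assume not: "\<not> openin C {x \<in> topspace C. g x \<in> U}"
  then obtain c where c: "c \<in> topspace C" "g c \<in> U"
    and c_lim: "\<And>W. openin C W \<Longrightarrow> c \<in> W \<Longrightarrow> \<exists>s\<in>W. g s \<notin> U"
    by (smt (verit, best) mem_Collect_eq openin_subopen openin_subset subset_iff)
  define \<N> where "\<N> = {V. openin X V \<and> g c \<in> V}"
  have "\<exists>M N. openin C M \<and> closedin C N \<and> c \<in> M \<and> M \<subseteq> N \<and> N \<subseteq> {x \<in> topspace C. g x \<in> V}"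
    if "V \<in> \<N>" for V
  proof -
    have "neighbourhood_base_of (closedin C) C"
      using C by (simp add: neighbourhood_base_of_closedin compact_Hausdorff_imp_regular_space)
    moreover have "openin C {x \<in> topspace C. g x \<in> V}"
      using that g by (auto simp: \<N>_def intro: openin_continuous_map_preimage)
    ultimately show ?thesis
      using that c by (auto simp: \<N>_def neighbourhood_base_of)
  qed
  then obtain M N where MN: "\<And>V. V \<in> \<N> \<Longrightarrow> openin C (M V) \<and> closedin C (N V) \<and> c \<in> M V \<and>
      M V \<subseteq> N V \<and> N V \<subseteq> {x \<in> topspace C. g x \<in> V}"
    by metis
  define G where "G = topspace C \<inter> \<Inter> (N ` \<N>)"
  have Gsub: "G \<subseteq> {x \<in> topspace C. g x \<in> V}" if "V \<in> \<N>" for V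
    using MN[OF that] that by (auto simp: G_def)
  have Gclosed: "closedin C G"
  proof -
    have "G = \<Inter> (insert (topspace C) (N ` \<N>))" by (auto simp: G_def)
    moreover have "closedin C (\<Inter> (insert (topspace C) (N ` \<N>)))"
      using MN by (intro closedin_Inter) auto
    ultimately show ?thesis by simp
  qed
  show False
  proof (cases "\<exists>s\<in>G. g s \<notin> U")
    case True
    then obtain s where s: "s \<in> G" "g s \<notin> U" by blast
    define K where "K = Alexandroff_compactification (discrete_topology (UNIV :: nat set))"
    define h where "h = (\<lambda>z :: nat option. if z = None then g c else g s)"
    have sC: "s \<in> topspace C" using s by (auto simp: G_def)
    have topK: "topspace K = UNIV"
      by (auto simp: K_def) (metis UNIV_I image_eqI not_Some_eq)
    have "continuous_map K X h"
      unfolding continuous_map_def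
    proof (intro conjI allI impI)
      show "h \<in> topspace K \<rightarrow> topspace X"
        using g c sC by (auto simp: h_def continuous_map_def)
      fix V assume V: "openin X V"
      consider "V \<in> \<N>" | "g c \<notin> V" using V by (auto simp: \<N>_def)
      then show "openin K {x \<in> topspace K. h x \<in> V}"
      proof cases
        case 1
        then have "{x \<in> topspace K. h x \<in> V} = topspace K"
          using Gsub[OF 1] s by (auto simp: h_def \<N>_def)
        then show ?thesis by simp
      next
        case 2
        then have "{x \<in> topspace K. h x \<in> V} = Some ` {n. g s \<in> V}"
          by (auto simp: h_def topK image_iff split: if_splits)
        then show ?thesis by (simp add: K_def)
      qed
    qed
    moreover have "compact_space K" "Hausdorff_space K"
      by (auto simp: K_def Hausdorff_space_Alexandroff_compactification
            locally_compact_space_discrete_topology)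
    moreover have "inj_on (\<lambda>z. {{{{Inl (case z of None \<Rightarrow> 0 | Some n \<Rightarrow> Suc n)}}}} :: 'a ktest) (topspace K)"
      by (auto simp: inj_on_def split: option.splits)
    ultimately have "openin K {x \<in> topspace K. h x \<in> U}"
      using kify_test_transport U by blast
    moreover have "{x \<in> topspace K. h x \<in> U} = {None}"
      using c s by (auto simp: h_def topK)
    ultimately have "openin K {None}" by simp
    then obtain Q where "compactin (discrete_topology (UNIV :: nat set)) Q"
        "{None} = insert None (Some ` (UNIV - Q))"
      by (auto simp: K_def openin_Alexandroff_compactification)
    then have "finite Q" "Q = UNIV"
      by (auto simp: compactin_discrete_topology)
    then show False by simp
  next
    case False
    have "\<exists>s. s \<in> topspace C \<and> g s \<notin> U \<and> (\<forall>V\<in>\<V>. s \<in> N V)"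
      if "finite \<V>" "\<V> \<subseteq> \<N>" for \<V>
    proof -
      have "openin C (\<Inter> (insert (topspace C) (M ` \<V>)))"
        using that MN by (intro openin_Inter) auto
      moreover have "c \<in> \<Inter> (insert (topspace C) (M ` \<V>))"
        using that MN c by auto
      ultimately obtain s where "s \<in> \<Inter> (insert (topspace C) (M ` \<V>))" "g s \<notin> U"
        using c_lim by blast
      then show ?thesis using that MN by blast
    qed
    then obtain s where s: "\<And>\<V>. finite \<V> \<Longrightarrow> \<V> \<subseteq> \<N> \<Longrightarrow>
        s \<V> \<in> topspace C \<and> g (s \<V>) \<notin> U \<and> (\<forall>V\<in>\<V>. s \<V> \<in> N V)"
      by metis
    define I where "I = {\<V>. finite \<V> \<and> \<V> \<subseteq> \<N>}"
    define E where "E = C closure_of (s ` I)"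
    have sI: "s ` I \<subseteq> topspace C" using s by (auto simp: I_def)
    have sE: "s ` I \<subseteq> E" using sI by (simp add: E_def closure_of_subset)
    have Esub: "E \<subseteq> topspace C" by (simp add: E_def closure_of_subset_topspace)
    have Eclosed: "closedin C E" by (simp add: E_def)
    define L where "L = subtopology C (E - G)"
    define K where "K = Alexandroff_compactification L"
    define h where "h = (\<lambda>z. case z of None \<Rightarrow> g c | Some x \<Rightarrow> g x)"
    have topL: "topspace L = E - G" using Esub by (auto simp: L_def)
    have topK: "topspace K = insert None (Some ` (E - G))" by (simp add: K_def topL)
    have L: "Hausdorff_space L" "locally_compact_space L"
    proof -
      show "Hausdorff_space L" using C by (simp add: L_def Hausdorff_space_subtopology)
      have "locally_compact_space (subtopology C E)"
        using C Eclosed by (metis closedin_compact_space compactin_subspace compact_imp_locally_compact_space)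
      moreover have "openin (subtopology C E) (E - G)"
        using Gclosed Esub by (metis Diff_eq Diff_Int_distrib2 openin_subtopology_Int2 closedin_def
             Int_Diff inf.absorb_iff1 openin_diff openin_topspace)
      ultimately have "locally_compact_space (subtopology (subtopology C E) (E - G))"
        using C by (blast intro: locally_compact_space_open_subset Hausdorff_space_subtopology)
      moreover have "subtopology (subtopology C E) (E - G) = L"
        by (simp add: L_def subtopology_subtopology Int_absorb1)
      ultimately show "locally_compact_space L" by simp
    qed
    have gL: "continuous_map L X g"
      using g by (simp add: L_def continuous_map_from_subtopology)
    have "continuous_map K X h"
      unfolding continuous_map_def
    proof (intro conjI allI impI)
      show "h \<in> topspace K \<rightarrow> topspace X"
        using g c Esub by (auto simp: h_def continuous_map_def topK)
      fix V assume V: "openin X V"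
      consider "V \<in> \<N>" | "g c \<notin> V" using V by (auto simp: \<N>_def)
      then show "openin K {x \<in> topspace K. h x \<in> V}"
      proof cases
        case 1
        define Q where "Q = E - {x \<in> topspace C. g x \<in> V}"
        have QG: "Q \<subseteq> E - G" using Gsub[OF 1] by (auto simp: Q_def)
        have Q: "closedin C Q"
          using Eclosed V g by (auto simp: Q_def intro!: closedin_diff openin_continuous_map_preimage)
        then have "compactin C Q" using C by (simp add: closedin_compact_space)
        then have "compactin L Q" using QG by (simp add: L_def compactin_subtopology)
        moreover have "closedin L Q"
          using Q QG by (metis L_def closedin_subset_topspace)
        moreover have "{x \<in> topspace K. h x \<in> V} = insert None (Some ` (topspace L - Q))"
          using 1 Esub by (auto simp: h_def topK topL Q_def \<N>_def)
        ultimately show ?thesis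
          unfolding K_def openin_Alexandroff_compactification by blast
      next
        case 2
        then have "{x \<in> topspace K. h x \<in> V} = Some ` {x \<in> topspace L. g x \<in> V}"
          by (auto simp: h_def topK topL)
        moreover have "openin L {x \<in> topspace L. g x \<in> V}"
          using V gL by (rule openin_continuous_map_preimage[rotated])
        ultimately show ?thesis by (simp add: K_def)
      qed
    qed
    moreover have "compact_space K" "Hausdorff_space K"
      using L by (auto simp: K_def Hausdorff_space_Alexandroff_compactification)
    moreover have "\<exists>j :: _ \<Rightarrow> 'a ktest. inj_on j (topspace K)"
    proof -
      define code where "code = (\<lambda>x. {{\<V> \<in> I. s \<V> \<in> W} | W. openin C W \<and> x \<in> W})"
      have ne: "code x \<noteq> {}" if "x \<in> E" for x
        using that Esub openin_topspace[of C] by (auto simp: code_def)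
      have inj: "x = y" if xy: "x \<in> E" "y \<in> E" "code x = code y" for x y
      proof (rule ccontr)
        assume "x \<noteq> y"
        then obtain W W' where W: "openin C W" "openin C W'" "x \<in> W" "y \<in> W'" "disjnt W W'"
          using C(2) xy(1,2) Esub unfolding Hausdorff_space_def by (meson subsetD)
        then have "{\<V> \<in> I. s \<V> \<in> W} \<in> code x" unfolding code_def by blast
        then have "{\<V> \<in> I. s \<V> \<in> W} \<in> code y" using xy(3) by simp
        then obtain W2 where W2: "openin C W2" "y \<in> W2" "{\<V> \<in> I. s \<V> \<in> W} = {\<V> \<in> I. s \<V> \<in> W2}"
          unfolding code_def by blast
        have "openin C (W2 \<inter> W')" "y \<in> W2 \<inter> W'" using W W2 by auto
        then obtain \<V> where "\<V> \<in> I" "s \<V> \<in> W2 \<inter> W'"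
          using xy(2) unfolding E_def in_closure_of by blast
        then show False using W W2 by (auto simp: disjnt_iff)
      qed
      define r :: "'a set set set set \<Rightarrow> 'a ktest" where "r = image (image (image (image Inr)))"
      have "inj r"
        by (simp add: r_def inj_def inj_image_eq_iff)
      moreover have "inj_on (\<lambda>z. case z of None \<Rightarrow> {} | Some x \<Rightarrow> code x) (topspace K)"
        unfolding topK
      proof (rule inj_onI)
        fix z w assume "z \<in> insert None (Some ` (E - G))" "w \<in> insert None (Some ` (E - G))"
          and "(case z of None \<Rightarrow> {} | Some x \<Rightarrow> code x) = (case w of None \<Rightarrow> {} | Some x \<Rightarrow> code x)"
        then show "z = w"
          using ne inj by (cases z; cases w) (auto; metis)+
      qed
      ultimately have "inj_on (r \<circ> (\<lambda>z. case z of None \<Rightarrow> {} | Some x \<Rightarrow> code x)) (topspace K)"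
        by (meson comp_inj_on inj_on_subset subset_UNIV)
      then show ?thesis by blast
    qed
    ultimately have "openin K {x \<in> topspace K. h x \<in> U}"
      using kify_test_transport U by blast
    moreover have "None \<in> {x \<in> topspace K. h x \<in> U}"
      using c by (simp add: topK h_def)
    ultimately obtain Q where Q: "compactin L Q"
        "{x \<in> topspace K. h x \<in> U} = insert None (Some ` (topspace L - Q))"
      by (auto simp: K_def openin_Alexandroff_compactification)
    have QG: "Q \<subseteq> E - G" and "closedin C Q"
      using Q(1) C(2) by (auto simp: L_def compactin_subtopology compactin_imp_closedin)
    moreover have "s ` I \<subseteq> Q"
    proof clarify
      fix \<V> assume V: "\<V> \<in> I"
      then have "g (s \<V>) \<notin> U" "s \<V> \<in> topspace C" using s by (auto simp: I_def)
      moreover from this have "s \<V> \<in> E - G" using V sE False by auto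
      ultimately have "Some (s \<V>) \<in> topspace K" "Some (s \<V>) \<notin> {x \<in> topspace K. h x \<in> U}"
        by (auto simp: topK h_def)
      then show "s \<V> \<in> Q" unfolding Q(2) using \<open>s \<V> \<in> E - G\<close> topL by auto
    qed
    ultimately have "E \<subseteq> Q" unfolding E_def by (simp add: closure_of_minimal)
    then have "E \<inter> G = {}" using QG by blast
    moreover have "\<Inter> (insert E (N ` \<N>)) \<noteq> {}"
    proof -
      have "\<Inter>\<F> \<noteq> {}" if F: "finite \<F>" "\<F> \<subseteq> insert E (N ` \<N>)" for \<F>
      proof -
        have "finite (\<F> - {E})" "\<F> - {E} \<subseteq> N ` \<N>" using F by auto
        then obtain \<V> where "finite \<V>" "\<V> \<subseteq> \<N>" "\<F> - {E} = N ` \<V>"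
          by (meson finite_subset_image)
        moreover from this have "s \<V> \<in> E" "\<forall>V\<in>\<V>. s \<V> \<in> N V"
          using s[of \<V>] sE unfolding I_def by blast+
        ultimately have "s \<V> \<in> D" if "D \<in> \<F>" for D
          using that by (cases "D = E") blast+
        then show ?thesis by blast
      qed
      moreover have "\<forall>D \<in> insert E (N ` \<N>). closedin C D" using Eclosed MN by auto
      ultimately show ?thesis
        using C(1)[unfolded compact_space_fip, rule_format, of "insert E (N ` \<N>)"] by simp
    qed
    moreover have "\<Inter> (insert E (N ` \<N>)) \<subseteq> E \<inter> G"
      using Esub by (auto simp: G_def)
    ultimately show False by blast
  qed
qed

section \<open>k-ified constructions\<close>

definition kprod :: "'a topology \<Rightarrow> 'b topology \<Rightarrow> ('a \<times> 'b) topology" where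
  "kprod X Y = kify (prod_topology X Y)"

definition pullback_space ::
    "'y topology \<Rightarrow> 'a topology \<Rightarrow> ('y \<Rightarrow> 'b) \<Rightarrow> ('a \<Rightarrow> 'b) \<Rightarrow> ('y \<times> 'a) topology" where
  "pullback_space Y A q f =
     kify (subtopology (kprod Y A) {(y, a). y \<in> topspace Y \<and> a \<in> topspace A \<and> q y = f a})"

definition weak_Hausdorff :: "'b topology \<Rightarrow> bool" where
  "weak_Hausdorff B \<longleftrightarrow> closedin (kprod B B) {(b, b) | b. b \<in> topspace B}"

section \<open>Fibrations and cofibrations\<close>

abbreviation unit_interval :: "real topology" where
  "unit_interval \<equiv> top_of_set {0..1}"

text \<open>
  Both notions quantify over all k-spaces \<open>Z\<close>; the type carrying \<open>Z\<close> is a parameter. Asserting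
  them with a free type variable \<open>'z\<close> means: for all k-spaces whatsoever. As hypotheses they are
  used at the type carrying the universal test space, to which every other one reduces:
  for the covering homotopy property of \<open>q : Y \<rightarrow> B\<close> the space of pairs \<open>(y, \<gamma>)\<close> with \<open>\<gamma>\<close> a path in
  \<open>B\<close> starting at \<open>q y\<close>, on \<open>'y \<times> (real \<Rightarrow> 'b)\<close>; for the homotopy extension property of
  \<open>i : B \<rightarrow> Y\<close> the mapping cylinder of \<open>i\<close>, on \<open>'y + 'b \<times> real\<close>.
\<close>

definition hurewicz_fibration ::
    "'z itself \<Rightarrow> 'y topology \<Rightarrow> 'b topology \<Rightarrow> ('y \<Rightarrow> 'b) \<Rightarrow> bool" where
  "hurewicz_fibration T Y B q \<longleftrightarrow>
     kspace Y \<and> kspace B \<and> continuous_map Y B q \<and>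
     (\<forall>(Z :: 'z topology) h H.
        kspace Z \<and> continuous_map Z Y h \<and> continuous_map (kprod Z unit_interval) B H \<and>
        (\<forall>z \<in> topspace Z. H (z, 0) = q (h z)) \<longrightarrow>
        (\<exists>G. continuous_map (kprod Z unit_interval) Y G \<and>
             (\<forall>z \<in> topspace Z. G (z, 0) = h z) \<and>
             (\<forall>z \<in> topspace Z. \<forall>s \<in> {0..1}. q (G (z, s)) = H (z, s))))"

definition closed_cofibration ::
    "'z itself \<Rightarrow> 'b topology \<Rightarrow> 'y topology \<Rightarrow> ('b \<Rightarrow> 'y) \<Rightarrow> bool" where
  "closed_cofibration T B Y i \<longleftrightarrow>
     kspace B \<and> kspace Y \<and> embedding_map B Y i \<and> closedin Y (i ` topspace B) \<and>
     (\<forall>(Z :: 'z topology) h H.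
        kspace Z \<and> continuous_map Y Z h \<and> continuous_map (kprod B unit_interval) Z H \<and>
        (\<forall>b \<in> topspace B. H (b, 0) = h (i b)) \<longrightarrow>
        (\<exists>G. continuous_map (kprod Y unit_interval) Z G \<and>
             (\<forall>y \<in> topspace Y. G (y, 0) = h y) \<and>
             (\<forall>b \<in> topspace B. \<forall>s \<in> {0..1}. G (i b, s) = H (b, s))))"

end

theory Submission
  imports Defs
begin

text \<open>
  A section \<open>t\<close> with closed image is a cofibration iff \<open>Y \<times> I\<close> retracts onto \<open>M = Y \<times> 0 \<union> t B \<times> I\<close>. If the
  retraction preserves the fibres of \<open>q\<close>, it can be pulled back along \<open>f\<close>, so the point is to make
  it fibrewise. Let \<open>r = (h, v)\<close> be any retraction, normalised so that \<open>h (y, s)\<close> is constant in \<open>s\<close>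
  beyond a time \<open>u y\<close> with \<open>u = 0\<close> on \<open>t B\<close>. Running the deformation backwards gives a path \<open>\<gamma>\<close> in \<open>B\<close>
  of length \<open>L = min s (u y)\<close> from \<open>q (h (y, s))\<close> to \<open>q y\<close>. Transport \<open>r (y, s)\<close> along \<open>\<gamma>\<close> within \<open>M\<close>:
  a point of \<open>t B\<close> at height \<open>v\<close> follows \<open>t \<circ> \<gamma>\<close> while its height drops at unit speed; once the height
  is \<open>0\<close> the covering homotopy property takes over. As \<open>L\<close> vanishes on \<open>M\<close>, nothing moves there.
\<close>

section \<open>Pasting, tubes and suprema over the unit interval\<close>

lemma continuous_map_comp:
  "continuous_map X Y g \<Longrightarrow> continuous_map Y Z f \<Longrightarrow> continuous_map X Z (\<lambda>x. f (g x))"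
  using continuous_map_compose[of X Y g Z f] by (simp add: o_def)

lemma continuous_map_paste_closed:
  assumes "closedin X S" "closedin X T" "topspace X \<subseteq> S \<union> T"
    and f: "continuous_map (subtopology X S) Y f" and g: "continuous_map (subtopology X T) Y g"
    and fg: "\<And>x. x \<in> S \<Longrightarrow> x \<in> T \<Longrightarrow> f x = g x"
  shows "continuous_map X Y (\<lambda>x. if x \<in> S then f x else g x)"
proof (rule pasting_lemma_closed[where I = "UNIV :: bool set" and T = "\<lambda>i. if i then S else T"
      and f = "\<lambda>i. if i then f else g"])
  show "\<exists>j. j \<in> UNIV \<and> x \<in> (if j then S else T) \<and>
      (if x \<in> S then f x else g x) = (if j then f else g) x" if "x \<in> topspace X" for x
    using that assms(3) by (cases "x \<in> S") (auto intro: exI[of _ True] exI[of _ False])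
qed (use assms in \<open>auto split: if_splits\<close>)

text \<open>The tube lemma thickens each good point to a neighbourhood of good points. It serves for
  suprema, for products with the interval and for path spaces.\<close>

lemma openin_forall_compact:
  assumes W: "openin (prod_topology X Y) W" and K: "compactin Y K"
  shows "openin X {x \<in> topspace X. \<forall>s\<in>K. (x, s) \<in> W}"
proof (subst openin_subopen, rule ballI)
  fix x assume "x \<in> {x \<in> topspace X. \<forall>s\<in>K. (x, s) \<in> W}"
  then have x: "x \<in> topspace X" "{x} \<times> K \<subseteq> W" by auto
  obtain U V where "openin X U" "openin Y V" "x \<in> U" "K \<subseteq> V" "U \<times> V \<subseteq> W"
    using tube_lemma_right[OF W K x] by blast
  then show "\<exists>T. openin X T \<and> x \<in> T \<and> T \<subseteq> {x \<in> topspace X. \<forall>s\<in>K. (x, s) \<in> W}"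
    using openin_subset by (intro exI[of _ U] conjI subsetI CollectI ballI) blast+
qed

lemma compactin_unit_interval: "0 \<le> a \<Longrightarrow> b \<le> 1 \<Longrightarrow> compactin unit_interval {a..b}"
  by (auto simp: compactin_subtopology)

lemma compact_space_unit_interval: "compact_space unit_interval"
  by (simp add: compact_space_subtopology)

lemma Hausdorff_space_unit_interval: "Hausdorff_space unit_interval"
  by (simp add: Hausdorff_space_subtopology)

lemma continuous_map_prod_slice:
  "continuous_map (prod_topology X Y) Z f \<Longrightarrow> x \<in> topspace X \<Longrightarrow> continuous_map Y Z (\<lambda>s. f (x, s))"
  by (rule continuous_map_comp[where g = "Pair x"]) (auto intro!: continuous_map_pairedI)

lemma continuous_map_prod_slice2:
  "continuous_map (prod_topology X Y) Z f \<Longrightarrow> y \<in> topspace Y \<Longrightarrow> continuous_map X Z (\<lambda>x. f (x, y))"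
  by (rule continuous_map_comp[where g = "\<lambda>x. (x, y)"]) (auto intro!: continuous_map_pairedI)

text \<open>A maximum over the interval exceeds \<open>a\<close> iff some value does, a union of
  open conditions, and is below \<open>a\<close> iff all values are, which is open by the tube
  lemma. This will give continuity of the time \<open>u\<close>.\<close>

lemma continuous_map_SUP_unit_interval:
  fixes f :: "'a \<times> real \<Rightarrow> real"
  assumes f: "continuous_map (prod_topology X unit_interval) euclideanreal f"
  shows "continuous_map X euclideanreal (\<lambda>x. SUP s\<in>{0..1}. f (x, s))"
    and "x \<in> topspace X \<Longrightarrow> \<exists>s\<in>{0..1}. (SUP s\<in>{0..1}. f (x, s)) = f (x, s)"
    and "x \<in> topspace X \<Longrightarrow> s \<in> {0..1} \<Longrightarrow> f (x, s) \<le> (SUP s\<in>{0..1}. f (x, s))"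
proof -
  have max: "\<exists>s\<in>{0..1}. (\<forall>s'\<in>{0..1}. f (x, s') \<le> f (x, s)) \<and> (SUP s\<in>{0..1}. f (x, s)) = f (x, s)"
    if "x \<in> topspace X" for x
  proof -
    have "continuous_on {0..1} (\<lambda>s. f (x, s))"
      using continuous_map_prod_slice[OF f that] by simp
    then obtain s where s: "s \<in> {0..1}" "\<forall>s'\<in>{0..1}. f (x, s') \<le> f (x, s)"
      using continuous_attains_sup[of "{0..1::real}" "\<lambda>s. f (x, s)"] by auto
    moreover have "(SUP s\<in>{0..1}. f (x, s)) = f (x, s)"
      using s by (intro cSup_eq_maximum) auto
    ultimately show ?thesis by blast
  qed
  show "x \<in> topspace X \<Longrightarrow> \<exists>s\<in>{0..1}. (SUP s\<in>{0..1}. f (x, s)) = f (x, s)"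
    using max by blast
  show "x \<in> topspace X \<Longrightarrow> s \<in> {0..1} \<Longrightarrow> f (x, s) \<le> (SUP s\<in>{0..1}. f (x, s))"
    using max by metis
  show "continuous_map X euclideanreal (\<lambda>x. SUP s\<in>{0..1}. f (x, s))"
    unfolding continuous_map_upper_lower_semicontinuous_lt
  proof (intro conjI allI)
    fix a :: real
    have "{x \<in> topspace X. a < (SUP s\<in>{0..1}. f (x, s))} =
        (\<Union>s\<in>{0..1}. {x \<in> topspace X. f (x, s) \<in> {a<..}})"
      using max by force
    moreover have "openin X {x \<in> topspace X. f (x, s) \<in> {a<..}}" if "s \<in> {0..1}" for s
      using continuous_map_prod_slice2[OF f, of s] that
      by (intro openin_continuous_map_preimage) auto
    ultimately show "openin X {x \<in> topspace X. a < (SUP s\<in>{0..1}. f (x, s))}"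
      by auto
    have "openin (prod_topology X unit_interval)
        {z \<in> topspace (prod_topology X unit_interval). f z \<in> {..<a}}"
      using f by (intro openin_continuous_map_preimage) auto
    from openin_forall_compact[OF this compactin_unit_interval[of 0 1]]
    have "openin X {x \<in> topspace X. \<forall>s\<in>{0..1}. f (x, s) < a}"
      by (rule back_subst[where P = "openin X"]) auto
    moreover have "{x \<in> topspace X. (SUP s\<in>{0..1}. f (x, s)) < a} =
        {x \<in> topspace X. \<forall>s\<in>{0..1}. f (x, s) < a}"
      using max by fastforce
    ultimately show "openin X {x \<in> topspace X. (SUP s\<in>{0..1}. f (x, s)) < a}"
      by simp
  qed
qed

section \<open>Universal property of k-ification, and products with the interval\<close>

lemma continuous_map_compact_Hausdorff_kify:
  assumes "compact_space C" "Hausdorff_space C" "continuous_map C X g"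
  shows "continuous_map C (kify X) g"
  using assms kify_test[OF assms] by (auto simp: continuous_map_def)

lemma continuous_map_kify_id: "continuous_map (kify X) X (\<lambda>x. x)"
  unfolding continuous_map_def
proof (intro conjI allI impI)
  fix U assume "openin X U"
  moreover from this have "{x \<in> topspace (kify X). x \<in> U} = U"
    using openin_subset by fastforce
  ultimately show "openin (kify X) {x \<in> topspace (kify X). x \<in> U}"
    by (simp add: openin_imp_openin_kify)
qed auto

text \<open>Openness in \<open>X\<close> is decided by its test maps, and these become test maps of
  \<open>Y\<close> after \<open>f\<close>. Their domains live on a type built from \<open>'a\<close>
  instead of \<open>'b\<close>, which is why \<open>kify_test\<close> is needed.\<close>

lemma continuous_map_into_kify:
  fixes X :: "'a topology" and Y :: "'b topology"
  assumes X: "kspace X" and f: "continuous_map X Y f"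
  shows "continuous_map X (kify Y) f"
  unfolding continuous_map_def
proof (intro conjI allI impI)
  show "f \<in> topspace X \<rightarrow> topspace (kify Y)" using f by (auto simp: continuous_map_def)
  fix U assume U: "openin (kify Y) U"
  have "openin (kify X) {x \<in> topspace X. f x \<in> U}"
    unfolding openin_kify
  proof (intro conjI allI impI)
    fix C :: "'a ktest topology" and g
    assume C: "compact_space C \<and> Hausdorff_space C \<and> continuous_map C X g"
    then have "openin C {x \<in> topspace C. f (g x) \<in> U}"
      using f U by (intro kify_test[where X = Y]) (auto intro: continuous_map_comp)
    moreover have "{x \<in> topspace C. g x \<in> {x \<in> topspace X. f x \<in> U}} = {x \<in> topspace C. f (g x) \<in> U}"
      using C by (auto simp: continuous_map_def)
    ultimately show "openin C {x \<in> topspace C. g x \<in> {x \<in> topspace X. f x \<in> U}}" by simp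
  qed auto
  then show "openin X {x \<in> topspace X. f x \<in> U}" using X by (simp add: kspace_def)
qed

lemma continuous_map_from_kify: "continuous_map X Y f \<Longrightarrow> continuous_map (kify X) Y f"
  using continuous_map_comp[OF continuous_map_kify_id] .

lemma continuous_map_out_of_kify: "continuous_map X (kify Y) f \<Longrightarrow> continuous_map X Y f"
  using continuous_map_comp[OF _ continuous_map_kify_id] .

lemma kspaceI:
  assumes "\<And>U. U \<subseteq> topspace X \<Longrightarrow> (\<And>(C :: 'a ktest topology) g. compact_space C \<Longrightarrow>
      Hausdorff_space C \<Longrightarrow> continuous_map C X g \<Longrightarrow> openin C {x \<in> topspace C. g x \<in> U}) \<Longrightarrow> openin X U"
  shows "kspace (X :: 'a topology)"
  unfolding kspace_def topology_eq
proof (intro allI iffI)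
  fix U assume "openin (kify X) U"
  then show "openin X U" unfolding openin_kify by (intro assms) auto
qed (rule openin_imp_openin_kify)

text \<open>Compact Hausdorff spaces have the same continuous maps into \<open>X\<close> and into
  \<open>kify X\<close>.\<close>

lemma kspace_kify: "kspace (kify (X :: 'a topology))"
proof (rule kspaceI)
  fix U
  assume U: "U \<subseteq> topspace (kify X)" and test: "\<And>(C :: 'a ktest topology) g. compact_space C \<Longrightarrow>
      Hausdorff_space C \<Longrightarrow> continuous_map C (kify X) g \<Longrightarrow> openin C {x \<in> topspace C. g x \<in> U}"
  show "openin (kify X) U"
    unfolding openin_kify
  proof (intro conjI allI impI)
    show "U \<subseteq> topspace X" using U by simp
  qed (auto intro: test continuous_map_compact_Hausdorff_kify)
qed

text \<open>Local compactness of the interval makes the ordinary product a k-space already, so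
  \<open>kprod\<close> can be replaced by the plain product in all homotopies.\<close>

lemma kspace_prod_unit_interval:
  fixes X :: "'a topology"
  assumes X: "kspace X"
  shows "kspace (prod_topology X unit_interval)"
proof (rule kspaceI)
  let ?I = unit_interval
  fix U assume U: "U \<subseteq> topspace (prod_topology X ?I)"
    and test: "\<And>(C :: ('a \<times> real) ktest topology) g. compact_space C \<Longrightarrow> Hausdorff_space C \<Longrightarrow>
      continuous_map C (prod_topology X ?I) g \<Longrightarrow> openin C {x \<in> topspace C. g x \<in> U}"
  have Uk: "openin (kify (prod_topology X ?I)) U"
    using U test by (auto simp: openin_kify)
  show "openin (prod_topology X ?I) U"
    unfolding openin_prod_topology_alt
  proof (intro allI impI)
    fix x s assume xs: "(x, s) \<in> U"
    then have x: "x \<in> topspace X" and s: "s \<in> {0..1}" using U by auto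
    have "openin ?I {w \<in> topspace ?I. (x, w) \<in> U}"
      using x by (intro kify_test[OF compact_space_unit_interval Hausdorff_space_unit_interval _ Uk])
        (auto intro!: continuous_map_pairedI)
    then obtain T where T: "open T" "{w \<in> {0..1}. (x, w) \<in> U} = T \<inter> {0..1}"
      by (auto simp: openin_subtopology)
    then have "s \<in> T" using xs s by auto
    then obtain e where e: "e > 0" "cball s e \<subseteq> T"
      using T(1) open_contains_cball by blast
    \<comment> \<open>A compact neighbourhood of \<open>s\<close> on which the slice of
      \<open>U\<close> over \<open>x\<close> is still full.\<close>
    define K where "K = {max 0 (s - e)..min 1 (s + e)}"
    have Kc: "compactin ?I K"
      unfolding K_def by (rule compactin_unit_interval) auto
    have KT: "K \<subseteq> T \<inter> {0..1}"
      using e(2) by (auto simp: K_def cball_eq_atLeastAtMost)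
    define V where "V = {z \<in> topspace X. \<forall>w\<in>K. (z, w) \<in> U}"
    \<comment> \<open>Pulled back to a test space \<open>C\<close>, the set \<open>V\<close> comes
      by the tube lemma from a subset of \<open>C \<times> I\<close>. That product is compact
      Hausdorff too, so \<open>kify_test\<close> makes the subset open, whatever type it lives
      on.\<close>
    have "openin (kify X) V"
      unfolding openin_kify
    proof (intro conjI allI impI)
      fix C :: "'a ktest topology" and g
      assume C: "compact_space C \<and> Hausdorff_space C \<and> continuous_map C X g"
      let ?W = "{z \<in> topspace (prod_topology C ?I). (g (fst z), snd z) \<in> U}"
      have "openin (prod_topology C ?I) ?W"
      proof (rule kify_test[OF _ _ _ Uk])
        show "compact_space (prod_topology C ?I)" "Hausdorff_space (prod_topology C ?I)"
          using C compact_space_unit_interval Hausdorff_space_unit_interval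
          by (auto simp: compact_space_prod_topology Hausdorff_space_prod_topology)
        show "continuous_map (prod_topology C ?I) (prod_topology X ?I) (\<lambda>z. (g (fst z), snd z))"
          using C continuous_map_fst continuous_map_snd
          by (intro continuous_map_pairedI) (auto intro: continuous_map_comp)
      qed
      from openin_forall_compact[OF this Kc]
      have "openin C {c \<in> topspace C. \<forall>w\<in>K. (c, w) \<in> ?W}" .
      moreover have "{c \<in> topspace C. \<forall>w\<in>K. (c, w) \<in> ?W} = {c \<in> topspace C. g c \<in> V}"
        using C KT by (auto simp: V_def continuous_map_def)
      ultimately show "openin C {c \<in> topspace C. g c \<in> V}" by simp
    qed (auto simp: V_def)
    then have "openin X V" using X by (simp add: kspace_def)
    moreover have "openin ?I (ball s e \<inter> {0..1})"
      by (auto simp: openin_subtopology)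
    moreover have "x \<in> V" using x KT T by (auto simp: V_def)
    moreover have "s \<in> ball s e \<inter> {0..1}" using s e by auto
    moreover have "V \<times> (ball s e \<inter> {0..1}) \<subseteq> U"
    proof clarify
      fix z w assume "z \<in> V" "w \<in> ball s e" "w \<in> {0..1}"
      moreover from this have "w \<in> K" by (auto simp: K_def dist_real_def)
      ultimately show "(z, w) \<in> U" by (simp add: V_def)
    qed
    ultimately show "\<exists>V T. openin X V \<and> openin ?I T \<and> x \<in> V \<and> s \<in> T \<and> V \<times> T \<subseteq> U"
      by blast
  qed
qed

lemma kprod_unit_interval: "kspace X \<Longrightarrow> kprod X unit_interval = prod_topology X unit_interval"
  using kspace_prod_unit_interval by (auto simp: kprod_def kspace_def)

section \<open>Maps into and out of the pullback space\<close>

lemma topspace_pullback_space: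
  "topspace (pullback_space Y A q f) = {(y, a). y \<in> topspace Y \<and> a \<in> topspace A \<and> q y = f a}"
  by (auto simp: pullback_space_def kprod_def)

lemma kspace_pullback_space: "kspace (pullback_space Y A q f)"
  by (simp add: pullback_space_def kspace_kify)

lemma continuous_map_pullback_space_proj:
  shows "continuous_map (pullback_space Y A q f) Y fst"
    and "continuous_map (pullback_space Y A q f) A snd"
  unfolding pullback_space_def kprod_def
  by (intro continuous_map_from_kify continuous_map_from_subtopology
      continuous_map_fst continuous_map_snd)+

lemma continuous_map_into_pullback_space:
  assumes "kspace Z" "continuous_map Z Y u" "continuous_map Z A v"
    and "\<And>z. z \<in> topspace Z \<Longrightarrow> q (u z) = f (v z)"
  shows "continuous_map Z (pullback_space Y A q f) (\<lambda>z. (u z, v z))"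
  unfolding pullback_space_def kprod_def
proof (intro continuous_map_into_kify continuous_map_into_subtopology continuous_map_pairedI)
  show "(\<lambda>z. (u z, v z)) \<in> topspace Z \<rightarrow> {(y, a). y \<in> topspace Y \<and> a \<in> topspace A \<and> q y = f a}"
    using assms(4) continuous_map_image_subset_topspace[OF assms(2)]
      continuous_map_image_subset_topspace[OF assms(3)] by auto
qed (use assms in auto)

section \<open>Covering homotopies for k-spaces on any type\<close>

text \<open>\<open>fib\<close> speaks of spaces on a single type. Every lifting problem is the
  pullback of the one carried by the k-ified space of pairs of a point and a path, so solving that
  one and composing with the classifying map suffices.\<close>

lemma hurewicz_fibration_lift:
  fixes Y :: "'y topology" and B :: "'b topology" and Z :: "'z topology"
  assumes fib: "hurewicz_fibration TYPE('y \<times> (real \<Rightarrow> 'b)) Y B q" and Z: "kspace Z"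
    and h: "continuous_map Z Y h" and H: "continuous_map (prod_topology Z unit_interval) B H"
    and H0: "\<And>z. z \<in> topspace Z \<Longrightarrow> H (z, 0) = q (h z)"
  obtains G where "continuous_map (prod_topology Z unit_interval) Y G"
    and "\<And>z. z \<in> topspace Z \<Longrightarrow> G (z, 0) = h z"
    and "\<And>z s. z \<in> topspace Z \<Longrightarrow> s \<in> {0..1} \<Longrightarrow> q (G (z, s)) = H (z, s)"
proof -
  let ?I = unit_interval
  have q: "continuous_map Y B q" using fib by (simp add: hurewicz_fibration_def)
  \<comment> \<open>The universal lifting problem: pairs of a point \<open>y\<close> and a path in \<open>B\<close> from \<open>q y\<close>, with the
    compact-open topology. Paths are arbitrary outside the unit interval, so this is not Hausdorff.\<close>
  define N where "N = (\<lambda>(U, a, b, V). {(y, \<gamma>). y \<in> U \<and> continuous_map ?I B \<gamma> \<and> \<gamma> 0 = q y \<and>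
      (\<forall>s\<in>{a..b}. \<gamma> s \<in> V)})"
  define \<N> where "\<N> = N ` {(U, a, b, V). openin Y U \<and> (0::real) \<le> a \<and> b \<le> 1 \<and> openin B V}"
  define P where "P = topology_generated_by \<N>"
  have N_open: "openin P (N (U, a, b, V))" if "openin Y U" "0 \<le> a" "b \<le> 1" "openin B V" for U a b V
    unfolding P_def \<N>_def using that by (intro topology_generated_by_Basis) auto
  have top_P: "topspace P = {(y, \<gamma>). y \<in> topspace Y \<and> continuous_map ?I B \<gamma> \<and> \<gamma> 0 = q y}"
    (is "_ = ?T")
  proof
    show "topspace P \<subseteq> ?T"
      unfolding P_def \<N>_def N_def by (auto dest: openin_subset)
    have "?T \<subseteq> N (topspace Y, 0, 1, topspace B)"
      by (auto simp: N_def continuous_map_def)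
    also have "\<dots> \<subseteq> topspace P"
      by (rule openin_subset[OF N_open]) auto
    finally show "?T \<subseteq> topspace P" .
  qed
  have fst_P: "continuous_map P Y fst"
    unfolding continuous_map_def
  proof (intro conjI allI impI)
    show "fst \<in> topspace P \<rightarrow> topspace Y" using top_P by auto
    fix U assume U: "openin Y U"
    then have "{x \<in> topspace P. fst x \<in> U} = N (U, 0, 1, topspace B)"
      unfolding top_P using openin_subset[OF U] by (auto simp: N_def continuous_map_def)
    then show "openin P {x \<in> topspace P. fst x \<in> U}"
      using N_open U by simp
  qed
  have eval_P: "continuous_map (prod_topology P ?I) B (\<lambda>(p, s). snd p s)"
    unfolding continuous_map_def
  proof (intro conjI allI impI)
    show "(\<lambda>(p, s). snd p s) \<in> topspace (prod_topology P ?I) \<rightarrow> topspace B"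
      by (auto simp: top_P continuous_map_def)
    fix V assume V: "openin B V"
    show "openin (prod_topology P ?I)
        {x \<in> topspace (prod_topology P ?I). (case x of (p, s) \<Rightarrow> snd p s) \<in> V}" (is "openin _ ?W")
      unfolding openin_prod_topology_alt
    proof (intro allI impI)
      fix p s assume "(p, s) \<in> ?W"
      then obtain y \<gamma> where p: "p = (y, \<gamma>)" "y \<in> topspace Y" "continuous_map ?I B \<gamma>" "\<gamma> 0 = q y"
        and s: "s \<in> {0..1}" "\<gamma> s \<in> V"
        by (auto simp: top_P)
      \<comment> \<open>By continuity \<open>\<gamma>\<close> sends a closed interval around
        \<open>s\<close> into \<open>V\<close>; the subbasic set for this interval makes all nearby
        paths do the same, so evaluation is continuous at \<open>(p, s)\<close>.\<close>
      have "openin ?I {w \<in> topspace ?I. \<gamma> w \<in> V}"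
        using p(3) V by (rule openin_continuous_map_preimage)
      then obtain T where T: "open T" "{w \<in> {0..1}. \<gamma> w \<in> V} = T \<inter> {0..1}"
        by (auto simp: openin_subtopology)
      then have "s \<in> T" using s by auto
      then obtain e where e: "e > 0" "cball s e \<subseteq> T"
        using T(1) open_contains_cball by blast
      define a b where "a = max 0 (s - e)" and "b = min 1 (s + e)"
      have ab: "w \<in> {a..b} \<longleftrightarrow> w \<in> cball s e \<inter> {0..1}" for w
        by (auto simp: a_def b_def cball_eq_atLeastAtMost)
      have "openin P (N (topspace Y, a, b, V))"
        using V by (intro N_open) (auto simp: a_def b_def)
      moreover have "openin ?I (ball s e \<inter> {0..1})"
        by (auto simp: openin_subtopology)
      moreover have "\<gamma> w \<in> V" if "w \<in> {a..b}" for w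
        using that[unfolded ab] e(2) T(2) by blast
      then have "p \<in> N (topspace Y, a, b, V)"
        using p by (simp add: N_def)
      moreover have "s \<in> ball s e \<inter> {0..1}" using s e by auto
      moreover have "w \<in> {a..b}" if "w \<in> ball s e" "w \<in> {0..1}" for w
        using that unfolding ab by auto
      then have "N (topspace Y, a, b, V) \<times> (ball s e \<inter> {0..1}) \<subseteq> ?W"
        unfolding N_def by (auto simp: top_P simp del: atLeastAtMost_iff mem_ball)
      ultimately show "\<exists>U T. openin P U \<and> openin ?I T \<and> p \<in> U \<and> s \<in> T \<and> U \<times> T \<subseteq> ?W"
        by blast
    qed
  qed
  \<comment> \<open>The covering homotopy property applies to k-spaces only, hence the passage to
    \<open>kify P\<close>.\<close>
  have "continuous_map (prod_topology (kify P) ?I) B (\<lambda>(p, s). snd p s)"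
    by (rule continuous_map_comp[OF _ eval_P, where g = "\<lambda>x. x", simplified])
      (auto simp: continuous_map_pairwise o_def continuous_map_snd
        intro: continuous_map_comp[OF continuous_map_fst continuous_map_kify_id])
  then obtain L where L: "continuous_map (prod_topology (kify P) ?I) Y L"
    "\<And>p. p \<in> topspace P \<Longrightarrow> L (p, 0) = fst p"
    "\<And>p s. p \<in> topspace P \<Longrightarrow> s \<in> {0..1} \<Longrightarrow> q (L (p, s)) = snd p s"
  proof -
    assume C: "continuous_map (prod_topology (kify P) ?I) B (\<lambda>(p, s). snd p s)"
    have "\<exists>L. continuous_map (kprod (kify P) ?I) Y L \<and> (\<forall>p\<in>topspace (kify P). L (p, 0) = fst p) \<and>
        (\<forall>p\<in>topspace (kify P). \<forall>s\<in>{0..1}. q (L (p, s)) = (\<lambda>(p, s). snd p s) (p, s))"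
      using fib[unfolded hurewicz_fibration_def] kspace_kify[of P] C
        continuous_map_from_kify[OF fst_P]
      by (elim conjE allE[of _ "kify P"] allE[of _ fst] allE[of _ "\<lambda>(p, s). snd p s"])
        (auto simp: kprod_unit_interval top_P)
    then show ?thesis
      using that kspace_kify[of P] by (auto simp: kprod_unit_interval)
  qed
  \<comment> \<open>The classifying map of the given problem. Preimages of subbasic sets are open by
    the tube lemma over the compact interval \<open>{a..b}\<close>.\<close>
  define k where "k = (\<lambda>z. (h z, \<lambda>s. H (z, s)))"
  have "continuous_map Z P k"
    unfolding P_def
  proof (rule continuous_on_generated_topo)
    show "k ` topspace Z \<subseteq> \<Union>\<N>"
    proof -
      have "k z \<in> topspace P" if "z \<in> topspace Z" for z
        using that h H0 continuous_map_prod_slice[OF H that]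
        by (auto simp: top_P k_def continuous_map_def)
      then show ?thesis by (auto simp: P_def)
    qed
    fix W assume "W \<in> \<N>"
    then obtain U a b V where W: "W = N (U, a, b, V)" and *: "openin Y U" "0 \<le> a" "b \<le> 1" "openin B V"
      by (auto simp: \<N>_def)
    let ?H = "{x \<in> topspace (prod_topology Z ?I). H x \<in> V}"
    have "openin (prod_topology Z ?I) ?H"
      using H *(4) by (rule openin_continuous_map_preimage)
    then have "openin Z {z \<in> topspace Z. \<forall>s\<in>{a..b}. (z, s) \<in> ?H}"
      by (rule openin_forall_compact[OF _ compactin_unit_interval[OF *(2,3)]])
    moreover have "openin Z {z \<in> topspace Z. h z \<in> U}"
      using h *(1) by (rule openin_continuous_map_preimage)
    ultimately have "openin Z ({z \<in> topspace Z. h z \<in> U} \<inter> {z \<in> topspace Z. \<forall>s\<in>{a..b}. (z, s) \<in> ?H})"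
      by blast
    moreover have "k -` W \<inter> topspace Z =
        {z \<in> topspace Z. h z \<in> U} \<inter> {z \<in> topspace Z. \<forall>s\<in>{a..b}. (z, s) \<in> ?H}"
      using *(2,3) H0 continuous_map_prod_slice[OF H] by (auto simp: W N_def k_def)
    ultimately show "openin Z (k -` W \<inter> topspace Z)" by simp
  qed
  then have k: "continuous_map Z (kify P) k" using Z by (simp add: continuous_map_into_kify)
  then have kz: "k z \<in> topspace P" if "z \<in> topspace Z" for z
    using that by (auto simp: continuous_map_def)
  show thesis
  proof (rule that)
    show "continuous_map (prod_topology Z ?I) Y (\<lambda>x. L (k (fst x), snd x))"
      using k by (intro continuous_map_comp[OF _ L(1)] continuous_map_pairedI continuous_map_snd
          continuous_map_comp[OF continuous_map_fst])
  qed (use L kz in \<open>auto simp: k_def\<close>)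
qed

section \<open>Closed cofibrations and retractions of the cylinder\<close>

text \<open>The homotopy extension property extends the canonical map of the mapping cylinder to all
  of \<open>Y \<times> I\<close>; following this extension by \<open>j\<close>, which maps the
  cylinder back into \<open>Y \<times> I\<close>, gives the retraction.\<close>

lemma closed_cofibration_retraction:
  fixes Y :: "'y topology" and B :: "'b topology"
  assumes cof: "closed_cofibration TYPE('y + 'b \<times> real) B Y t"
  obtains r where "continuous_map (prod_topology Y unit_interval) (prod_topology Y unit_interval) r"
    and "\<And>y. y \<in> topspace Y \<Longrightarrow> r (y, 0) = (y, 0)"
    and "\<And>b s. b \<in> topspace B \<Longrightarrow> s \<in> {0..1} \<Longrightarrow> r (t b, s) = (t b, s)"
    and "\<And>y s. y \<in> topspace Y \<Longrightarrow> s \<in> {0..1} \<Longrightarrow>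
      snd (r (y, s)) = 0 \<or> fst (r (y, s)) \<in> t ` topspace B"
proof -
  let ?I = unit_interval
  have ks: "kspace B" "kspace Y" and t: "continuous_map B Y t"
    using cof by (auto simp: closed_cofibration_def embedding_map_def homeomorphic_imp_continuous_map
        dest!: homeomorphic_imp_continuous_map continuous_map_into_fulltopology)
  have tB: "b \<in> topspace B \<Longrightarrow> t b \<in> topspace Y" for b
    using t by (auto simp: continuous_map_def)
  \<comment> \<open>The mapping cylinder, replaced by the topology induced from \<open>Y \<times> I\<close>; \<open>Inr (b, 0)\<close> is an
    indistinguishable duplicate of \<open>Inl (t b)\<close>.\<close>
  define j where "j = case_sum (\<lambda>y. (y, 0)) (\<lambda>(b, s). (t b, s :: real))"
  define S where "S = Inl ` topspace Y \<union> Inr ` (topspace B \<times> {0..1::real})"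
  define Z where "Z = pullback_topology S j (prod_topology Y ?I)"
  have top_Z: "topspace Z = S"
    using tB by (auto simp: Z_def topspace_pullback_topology S_def j_def)
  \<comment> \<open>At height 0 the value avoids the duplicate \<open>Inr (b, 0)\<close>, so that
    \<open>H\<close> starts exactly at \<open>Inl (t b)\<close>.\<close>
  define H where "H = (\<lambda>(b, s :: real). if s = 0 then Inl (t b) else Inr (b, s))"
  \<comment> \<open>The topology of \<open>Z\<close> is pulled back along \<open>j\<close>, so
    continuity into it is checked after \<open>j\<close>.\<close>
  have into_Z: "continuous_map X (kify Z) u"
    if "kspace X" "continuous_map X (prod_topology Y ?I) (j \<circ> u)" "u ` topspace X \<subseteq> S"
    for X :: "'x topology" and u
    using that unfolding Z_def
    by (intro continuous_map_into_kify continuous_map_pullback') auto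
  have jH: "j (H (b, s)) = (t b, s)" for b s by (auto simp: j_def H_def)
  have "\<exists>G. continuous_map (kprod Y ?I) (kify Z) G \<and> (\<forall>y\<in>topspace Y. G (y, 0) = Inl y) \<and>
      (\<forall>b\<in>topspace B. \<forall>s\<in>{0..1}. G (t b, s) = H (b, s))"
  proof -
    have "continuous_map Y (kify Z) Inl"
      using ks by (intro into_Z) (auto simp: S_def j_def o_def intro!: continuous_map_pairedI)
    moreover have "continuous_map (kprod B ?I) (kify Z) H"
      unfolding kprod_unit_interval[OF ks(1)]
    proof (rule into_Z)
      show "kspace (prod_topology B ?I)" using ks by (simp add: kspace_prod_unit_interval)
      show "continuous_map (prod_topology B ?I) (prod_topology Y ?I) (j \<circ> H)"
      proof -
        have "j \<circ> H = (\<lambda>x. (t (fst x), snd x))" using jH by force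
        then show ?thesis
          using t by (auto intro!: continuous_map_pairedI continuous_map_snd
              continuous_map_comp[OF continuous_map_fst])
      qed
      show "H ` topspace (prod_topology B ?I) \<subseteq> S"
        using tB by (auto simp: H_def S_def)
    qed
    ultimately show ?thesis
      using cof[unfolded closed_cofibration_def] kspace_kify[of Z]
      by (elim conjE allE[of _ "kify Z"] allE[of _ Inl] allE[of _ H]) (auto simp: H_def)
  qed
  then obtain G where G: "continuous_map (prod_topology Y ?I) (kify Z) G"
    "\<And>y. y \<in> topspace Y \<Longrightarrow> G (y, 0) = Inl y"
    "\<And>b s. b \<in> topspace B \<Longrightarrow> s \<in> {0..1} \<Longrightarrow> G (t b, s) = H (b, s)"
    using ks by (auto simp: kprod_unit_interval)
  have GS: "G x \<in> S" if "x \<in> topspace (prod_topology Y ?I)" for x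
    using G(1) that unfolding continuous_map_def top_Z[symmetric] by auto
  have "continuous_map Z (prod_topology Y ?I) j"
    using continuous_map_pullback[OF continuous_map_id, of _ j] by (simp add: Z_def)
  then have "continuous_map (prod_topology Y ?I) (prod_topology Y ?I) (\<lambda>x. j (G x))"
    using continuous_map_comp[OF continuous_map_out_of_kify[OF G(1)]] by blast
  then show thesis
  proof (rule that)
    show "snd (j (G (y, s))) = 0 \<or> fst (j (G (y, s))) \<in> t ` topspace B"
      if "y \<in> topspace Y" "s \<in> {0..1}" for y s
      using GS[of "(y, s)"] that by (auto simp: S_def j_def)
  qed (use G jH in \<open>auto simp: j_def\<close>)
qed

text \<open>Both pieces of \<open>E \<times> 0 \<union> i A \<times> I\<close> are closed, so
  \<open>h\<close> and \<open>H\<close>, the latter read through the left inverse \<open>p\<close>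
  of \<open>i\<close>, paste to a map on the union. Composing it with \<open>r\<close> gives the
  extension.\<close>

lemma closed_cofibrationI_retraction:
  fixes E :: "'e topology" and A :: "'a topology"
  assumes ks: "kspace A" "kspace E" and ret: "retraction_maps E A p i"
    and clo: "closedin E (i ` topspace A)"
    and r: "continuous_map (prod_topology E unit_interval) (prod_topology E unit_interval) r"
    and r0: "\<And>y. y \<in> topspace E \<Longrightarrow> r (y, 0) = (y, 0)"
    and ri: "\<And>a s. a \<in> topspace A \<Longrightarrow> s \<in> {0..1} \<Longrightarrow> r (i a, s) = (i a, s)"
    and rM: "\<And>y s. y \<in> topspace E \<Longrightarrow> s \<in> {0..1} \<Longrightarrow>
      snd (r (y, s)) = 0 \<or> fst (r (y, s)) \<in> i ` topspace A"
  shows "closed_cofibration TYPE('w) A E i"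
proof -
  let ?I = unit_interval and ?X = "prod_topology E unit_interval"
  have p: "continuous_map E A p" and i: "continuous_map A E i" and pi: "\<And>a. a \<in> topspace A \<Longrightarrow> p (i a) = a"
    using ret by (auto simp: retraction_maps_def)
  have emb: "embedding_map A E i"
    using ret by (intro section_imp_embedding_map) (auto simp: section_map_def)
  have r1: "continuous_map ?X E (\<lambda>x. fst (r x))" and r2: "continuous_map ?X ?I (\<lambda>x. snd (r x))"
    using continuous_map_comp[OF r continuous_map_fst] continuous_map_comp[OF r continuous_map_snd] by auto
  have "\<exists>G. continuous_map (kprod E ?I) Z G \<and> (\<forall>y\<in>topspace E. G (y, 0) = h y) \<and>
      (\<forall>a\<in>topspace A. \<forall>s\<in>{0..1}. G (i a, s) = H (a, s))"
    if h: "continuous_map E Z h" and H: "continuous_map (kprod A ?I) Z H"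
      and H0: "\<forall>a\<in>topspace A. H (a, 0) = h (i a)" for Z :: "'w topology" and h H
  proof -
    define S where "S = {x \<in> topspace ?X. snd (r x) \<in> {0}}"
    define T where "T = {x \<in> topspace ?X. fst (r x) \<in> i ` topspace A}"
    define G where "G = (\<lambda>x. if x \<in> S then h (fst (r x)) else H (p (fst (r x)), snd (r x)))"
    have "continuous_map ?X Z G"
      unfolding G_def
    proof (rule continuous_map_paste_closed[where T = T])
      have "closedin ?I {0}" by (simp add: closed_subset)
      with r2 show "closedin ?X S" unfolding S_def by (rule closedin_continuous_map_preimage)
      show "closedin ?X T" unfolding T_def using r1 clo by (rule closedin_continuous_map_preimage)
      show "topspace ?X \<subseteq> S \<union> T" using rM by (fastforce simp: S_def T_def)
      show "continuous_map (subtopology ?X S) Z (\<lambda>x. h (fst (r x)))"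
        using r1 h by (intro continuous_map_from_subtopology) (rule continuous_map_comp)
      show "continuous_map (subtopology ?X T) Z (\<lambda>x. H (p (fst (r x)), snd (r x)))"
        using r2 by (intro continuous_map_from_subtopology continuous_map_pairedI
            continuous_map_comp[OF _ H[unfolded kprod_unit_interval[OF ks(1)]]]
            continuous_map_comp[OF r1 p])
      show "h (fst (r x)) = H (p (fst (r x)), snd (r x))" if "x \<in> S" "x \<in> T" for x
        using that H0 pi by (auto simp: S_def T_def)
    qed
    moreover have "G (y, 0) = h y" if "y \<in> topspace E" for y
      using that r0 by (simp add: G_def S_def)
    moreover have "G (i a, s) = H (a, s)" if "a \<in> topspace A" "s \<in> {0..1}" for a s
      using that ri pi H0 i by (auto simp: G_def S_def continuous_map_def)
    ultimately show ?thesis using ks by (auto simp: kprod_unit_interval)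
  qed
  then show ?thesis
    unfolding closed_cofibration_def using ks emb clo by blast
qed

section \<open>A retraction preserving the fibres of q\<close>

lemma fibrewise_retraction:
  fixes Y :: "'y topology" and B :: "'b topology"
  assumes fib: "hurewicz_fibration TYPE('y \<times> (real \<Rightarrow> 'b)) Y B q"
    and ret: "retraction_maps Y B q t"
    and cof: "closed_cofibration TYPE('y + 'b \<times> real) B Y t"
  obtains \<rho> where "continuous_map (prod_topology Y unit_interval) (prod_topology Y unit_interval) \<rho>"
    and "\<And>y. y \<in> topspace Y \<Longrightarrow> \<rho> (y, 0) = (y, 0)"
    and "\<And>b s. b \<in> topspace B \<Longrightarrow> s \<in> {0..1} \<Longrightarrow> \<rho> (t b, s) = (t b, s)"
    and "\<And>y s. y \<in> topspace Y \<Longrightarrow> s \<in> {0..1} \<Longrightarrow>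
      snd (\<rho> (y, s)) = 0 \<or> fst (\<rho> (y, s)) \<in> t ` topspace B"
    and "\<And>y s. y \<in> topspace Y \<Longrightarrow> s \<in> {0..1} \<Longrightarrow> q (fst (\<rho> (y, s))) = q y"
proof -
  let ?I = unit_interval and ?X = "prod_topology Y unit_interval"
  have ksY: "kspace Y" and q: "continuous_map Y B q" and t: "continuous_map B Y t"
    and qt: "\<And>b. b \<in> topspace B \<Longrightarrow> q (t b) = b"
    using fib ret by (auto simp: hurewicz_fibration_def retraction_maps_def)
  have clo: "closedin Y (t ` topspace B)" using cof by (simp add: closed_cofibration_def)
  have tY: "b \<in> topspace B \<Longrightarrow> t b \<in> topspace Y" for b
    using t by (auto simp: continuous_map_def)
  have qB: "y \<in> topspace Y \<Longrightarrow> q y \<in> topspace B" for y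
    using q by (auto simp: continuous_map_def)
  obtain r where r: "continuous_map ?X ?X r"
    and r_0: "\<And>y. y \<in> topspace Y \<Longrightarrow> r (y, 0) = (y, 0)"
    and r_t: "\<And>b s. b \<in> topspace B \<Longrightarrow> s \<in> {0..1} \<Longrightarrow> r (t b, s) = (t b, s)"
    and r_M: "\<And>y s. y \<in> topspace Y \<Longrightarrow> s \<in> {0..1} \<Longrightarrow>
      snd (r (y, s)) = 0 \<or> fst (r (y, s)) \<in> t ` topspace B"
    using closed_cofibration_retraction[OF cof] by blast
  define h where "h = (\<lambda>x. fst (r x))"
  have h: "continuous_map ?X Y h"
    unfolding h_def by (rule continuous_map_comp[OF r continuous_map_fst])
  have hY: "h (y, s) \<in> topspace Y" if "y \<in> topspace Y" "s \<in> {0..1}" for y s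
    using continuous_map_image_subset_topspace[OF h] that by auto
  have sndR: "continuous_map ?X euclideanreal snd"
    using continuous_map_snd[of Y ?I] by (simp add: continuous_map_in_subtopology)
  have r2: "continuous_map ?X euclideanreal (\<lambda>x. snd (r x))"
    by (rule continuous_map_comp[OF r sndR])
  \<comment> \<open>The largest height error of \<open>r\<close> over \<open>y\<close>. At a time
    \<open>s > u y\<close> the height of \<open>r (y, s)\<close> is at least
    \<open>s - u y > 0\<close>, which forces \<open>h (y, s)\<close> into the image of
    \<open>t\<close>. There is no error over that image itself.\<close>
  define u where "u = (\<lambda>y. SUP s\<in>{0..1}. \<bar>s - snd (r (y, s))\<bar>)"
  have d: "continuous_map ?X euclideanreal (\<lambda>x. \<bar>snd x - snd (r x)\<bar>)"
    by (intro continuous_map_real_abs continuous_map_diff sndR r2)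
  have u: "continuous_map Y euclideanreal u"
    unfolding u_def by (rule continuous_map_SUP_unit_interval(1)[OF d, simplified fst_conv snd_conv])
  have u_ge: "\<bar>s - snd (r (y, s))\<bar> \<le> u y" if "y \<in> topspace Y" "s \<in> {0..1}" for y s
    unfolding u_def
    using continuous_map_SUP_unit_interval(3)[OF d that] by simp
  have u_nonneg: "0 \<le> u y" if "y \<in> topspace Y" for y
    using u_ge[OF that, of 0] by simp
  have u_t: "u (t b) = 0" if "b \<in> topspace B" for b
  proof -
    have "\<exists>s\<in>{0..1}. u (t b) = \<bar>s - snd (r (t b, s))\<bar>"
      unfolding u_def using continuous_map_SUP_unit_interval(2)[OF d tY[OF that]] by simp
    then show ?thesis using r_t that by auto
  qed
  \<comment> \<open>Times shortly after \<open>u y\<close> have positive height; \<open>u y\<close>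
    is their limit and the image of \<open>t\<close> is closed.\<close>
  have h_after: "h (y, u y) \<in> t ` topspace B" if y: "y \<in> topspace Y" and s: "s \<in> {0..1}" "u y < s" for y s
  proof -
    have "closedin ?I {w \<in> topspace ?I. h (y, w) \<in> t ` topspace B}"
      using continuous_map_prod_slice[OF h y] clo by (rule closedin_continuous_map_preimage)
    then have D: "closed {w \<in> {0..1}. h (y, w) \<in> t ` topspace B}"
      by (simp add: closedin_closed_eq)
    have "{u y<..<s} \<subseteq> {w \<in> {0..1}. h (y, w) \<in> t ` topspace B}"
    proof
      fix w assume w: "w \<in> {u y<..<s}"
      then have wI: "w \<in> {0..1}" using s u_nonneg[OF y] by auto
      then have "snd (r (y, w)) \<noteq> 0" using u_ge[OF y wI] w by auto
      then show "w \<in> {w \<in> {0..1}. h (y, w) \<in> t ` topspace B}"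
        using r_M[OF y wI] wI by (simp add: h_def)
    qed
    then have "closure {u y<..<s} \<subseteq> {w \<in> {0..1}. h (y, w) \<in> t ` topspace B}"
      using D by (rule closure_minimal)
    moreover have "u y \<in> closure {u y<..<s}" using s by simp
    ultimately show ?thesis by blast
  qed

  \<comment> \<open>Over \<open>z = (y, s)\<close> the deformation is frozen from time \<open>u y\<close> on: the retraction used is
    \<open>z \<mapsto> (h (y, L z), v z)\<close>, and \<open>\<gamma> z\<close> is the path of length \<open>L z\<close> leading from its fibre back to
    that of \<open>y\<close>. In \<open>\<gamma> z w\<close> the maximum keeps the path constant after its end.\<close>
  define L where "L = (\<lambda>z. min (snd z) (u (fst z)))"
  define v where "v = (\<lambda>z. snd z - L z)"
  define m where "m = (\<lambda>z. min (v z) (L z))"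
  have uX: "continuous_map ?X euclideanreal (\<lambda>z. u (fst z))"
    by (rule continuous_map_comp[OF continuous_map_fst u])
  have L: "continuous_map ?X euclideanreal L"
    unfolding L_def by (intro continuous_map_real_min sndR uX)
  have v: "continuous_map ?X euclideanreal v"
    unfolding v_def by (intro continuous_map_diff sndR L)
  have m: "continuous_map ?X euclideanreal m"
    unfolding m_def by (intro continuous_map_real_min v L)
  have bounds: "0 \<le> L z" "L z \<le> 1" "0 \<le> v z" "v z \<le> 1" "0 \<le> m z" "m z \<le> L z" "m z \<le> v z"
    if "z \<in> topspace ?X" for z
    using that u_nonneg[of "fst z"] by (auto simp: L_def v_def m_def)
  define \<gamma> where "\<gamma> = (\<lambda>z w. q (h (fst z, max (L z - w) 0)))"
  \<comment> \<open>Stated for general \<open>a\<close> and \<open>w\<close> because the path is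
    evaluated at \<open>m z\<close> in \<open>e\<close> and at \<open>m z\<close> plus a parameter
    in the homotopy to be lifted. Nonnegative \<open>w\<close> keeps the deformation time in the
    unit interval.\<close>
  have \<gamma>: "continuous_map Z B (\<lambda>x. \<gamma> (a x) (w x))"
    if a: "continuous_map Z ?X a" and w: "continuous_map Z euclideanreal w"
      and pos: "\<And>x. x \<in> topspace Z \<Longrightarrow> 0 \<le> w x" for Z :: "'x topology" and a w
  proof -
    have aX: "a x \<in> topspace ?X" if "x \<in> topspace Z" for x
      using a that by (auto simp: continuous_map_def)
    have "continuous_map Z ?I (\<lambda>x. max (L (a x) - w x) 0)"
      unfolding continuous_map_in_subtopology
    proof
      show "continuous_map Z euclideanreal (\<lambda>x. max (L (a x) - w x) 0)"
        by (intro continuous_map_real_max continuous_map_diff w continuous_map_comp[OF a L]) auto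
      show "(\<lambda>x. max (L (a x) - w x) 0) \<in> topspace Z \<rightarrow> {0..1}"
        using pos bounds(2)[OF aX] by fastforce
    qed
    then show ?thesis
      unfolding \<gamma>_def
      by (intro continuous_map_comp[OF _ q] continuous_map_comp[OF _ h] continuous_map_pairedI
          continuous_map_comp[OF a continuous_map_fst])
  qed
  have \<gamma>B: "\<gamma> z w \<in> topspace B" if "z \<in> topspace ?X" "0 \<le> w" for z w
    using that bounds[OF that(1)] unfolding \<gamma>_def by (intro qB hY) auto
  have \<gamma>0: "\<gamma> z 0 = q (h (fst z, L z))" if "z \<in> topspace ?X" for z
    using bounds(1)[OF that] by (simp add: \<gamma>_def max.absorb1)
  \<comment> \<open>The path ends at deformation time 0, where \<open>r\<close> is the
    identity.\<close>
  have \<gamma>L: "\<gamma> z (L z) = q (fst z)" if "z \<in> topspace ?X" for z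
    using that r_0 by (auto simp: \<gamma>_def h_def)

  \<comment> \<open>A point \<open>(t b, v)\<close> first moves along \<open>t \<circ> \<gamma>\<close> for the time \<open>m = min v L\<close>, at the cost of lowering
    its height by \<open>m\<close>; \<open>e\<close> is where it arrives. Only the rest of the path, of length \<open>L - m\<close>, is lifted.\<close>
  define S where "S = {z \<in> topspace ?X. v z \<in> {0}}"
  define T where "T = {z \<in> topspace ?X. h (fst z, L z) \<in> t ` topspace B}"
  define e where "e = (\<lambda>z. if z \<in> S then h (fst z, L z) else t (\<gamma> z (m z)))"
  have mS: "m z = 0" if "z \<in> S" for z
    using that bounds[of z] by (auto simp: S_def m_def)
  have e: "continuous_map ?X Y e"
    unfolding e_def
  proof (rule continuous_map_paste_closed[where T = T])
    have hL: "continuous_map ?X Y (\<lambda>z. h (fst z, L z))"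
    proof (intro continuous_map_comp[OF _ h] continuous_map_pairedI continuous_map_fst)
      show "continuous_map ?X ?I L"
        using L bounds(1,2) by (auto simp: continuous_map_in_subtopology)
    qed
    show "closedin ?X S" unfolding S_def using v by (rule closedin_continuous_map_preimage) auto
    show "closedin ?X T" unfolding T_def using hL clo by (rule closedin_continuous_map_preimage)
    show "topspace ?X \<subseteq> S \<union> T"
    proof
      fix z assume z: "z \<in> topspace ?X"
      show "z \<in> S \<union> T"
      proof (cases "v z = 0")
        case False
        \<comment> \<open>Nonzero height means that the time has passed \<open>u (fst z)\<close>,
          which is the situation of \<open>h_after\<close>.\<close>
        then have "u (fst z) < snd z" "L z = u (fst z)" by (auto simp: v_def L_def min_def split: if_splits)
        then show ?thesis using h_after[of "fst z" "snd z"] z by (auto simp: T_def)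
      qed (use z in \<open>simp add: S_def\<close>)
    qed
    show "continuous_map (subtopology ?X S) Y (\<lambda>z. h (fst z, L z))"
      using hL by (rule continuous_map_from_subtopology)
    have "continuous_map ?X B (\<lambda>z. \<gamma> z (m z))"
      using bounds(5) by (intro \<gamma> m continuous_map_id[unfolded id_def])
    then show "continuous_map (subtopology ?X T) Y (\<lambda>z. t (\<gamma> z (m z)))"
      using t by (intro continuous_map_from_subtopology) (rule continuous_map_comp)
    \<comment> \<open>On the overlap \<open>m z = 0\<close>, and \<open>t\<close> inverts
      \<open>q\<close> on the image of \<open>t\<close>.\<close>
    show "h (fst z, L z) = t (\<gamma> z (m z))" if "z \<in> S" "z \<in> T" for z
      using that mS[OF that(1)] \<gamma>0[of z] qt by (auto simp: T_def)
  qed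
  have qe: "\<gamma> z (m z) = q (e z)" if "z \<in> topspace ?X" for z
    using that mS \<gamma>0 qt \<gamma>B bounds(5) by (auto simp: e_def)
  \<comment> \<open>The rest of the path after time \<open>m\<close>. The parameter may overrun the
    end, where the path rests at \<open>q y\<close>.\<close>
  have H: "continuous_map (prod_topology ?X ?I) B (\<lambda>x. \<gamma> (fst x) (m (fst x) + snd x))"
  proof (intro \<gamma> continuous_map_fst continuous_map_add)
    show "continuous_map (prod_topology ?X ?I) euclideanreal (\<lambda>x. m (fst x))"
      by (rule continuous_map_comp[OF continuous_map_fst m])
    show "continuous_map (prod_topology ?X ?I) euclideanreal snd"
      using continuous_map_snd[of ?X ?I] by (simp add: continuous_map_in_subtopology)
    show "0 \<le> m (fst x) + snd x" if "x \<in> topspace (prod_topology ?X ?I)" for x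
      using that bounds(5)[of "fst x"] by (auto simp: mem_Times_iff)
  qed
  obtain G where G: "continuous_map (prod_topology ?X ?I) Y G"
    and G0: "\<And>z. z \<in> topspace ?X \<Longrightarrow> G (z, 0) = e z"
    and qG: "\<And>z w. z \<in> topspace ?X \<Longrightarrow> w \<in> {0..1} \<Longrightarrow> q (G (z, w)) = \<gamma> z (m z + w)"
    using hurewicz_fibration_lift[OF fib kspace_prod_unit_interval[OF ksY] e H] qe by auto
  \<comment> \<open>The lift is stopped when its projection reaches \<open>\<gamma> z (L z)\<close>,
    that is, the fibre of the original point.\<close>
  define \<rho> where "\<rho> = (\<lambda>z. (G (z, L z - m z), v z - m z))"
  show thesis
  proof (rule that)
    have "continuous_map ?X ?I (\<lambda>z. L z - m z)" "continuous_map ?X ?I (\<lambda>z. v z - m z)"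
      unfolding continuous_map_in_subtopology using bounds
      by (auto intro!: continuous_map_diff L m v simp: Pi_iff) (smt (verit))+
    then show "continuous_map ?X ?X \<rho>"
      unfolding \<rho>_def
      by (intro continuous_map_pairedI continuous_map_comp[OF _ G] continuous_map_id[unfolded id_def])
    show "\<rho> (y, 0) = (y, 0)" if "y \<in> topspace Y" for y
    proof -
      have "L (y, 0) = 0" "v (y, 0) = 0" "m (y, 0) = 0"
        using u_nonneg[OF that] by (auto simp: L_def v_def m_def)
      then show ?thesis
        using that G0[of "(y, 0)"] r_0 by (simp add: \<rho>_def e_def S_def h_def)
    qed
    show "\<rho> (t b, s) = (t b, s)" if "b \<in> topspace B" "s \<in> {0..1}" for b s
    proof -
      \<comment> \<open>No time is left for lifting, so the first coordinate is
        \<open>e (t b, s)\<close>. This is \<open>h (t b, 0)\<close> if \<open>s = 0\<close> and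
        \<open>t (q (t b))\<close> otherwise, in both cases \<open>t b\<close>.\<close>
      have "L (t b, s) = 0" "v (t b, s) = s" "m (t b, s) = 0"
        using that by (auto simp: L_def v_def m_def u_t)
      then show ?thesis
        using that tY G0[of "(t b, s)"] r_0 \<gamma>0[of "(t b, s)"] qt by (simp add: \<rho>_def e_def h_def)
    qed
    fix y and s :: real assume ys: "y \<in> topspace Y" "s \<in> {0..1}"
    define z where "z = (y, s)"
    have z: "z \<in> topspace ?X" using ys by (simp add: z_def)
    \<comment> \<open>If \<open>v z \<le> L z\<close>, the whole height is spent. Otherwise the path
      ends first, so \<open>m z = L z\<close>, nothing is lifted, and the point stays in the image
      of \<open>t\<close>.\<close>
    show "snd (\<rho> (y, s)) = 0 \<or> fst (\<rho> (y, s)) \<in> t ` topspace B"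
    proof (cases "v z \<le> L z")
      case False
      then have "m z = L z" "z \<notin> S" using bounds(1)[OF z] by (auto simp: m_def S_def)
      then show ?thesis
        using z G0[OF z] \<gamma>B[OF z bounds(5)[OF z]] by (simp add: \<rho>_def e_def z_def)
    qed (simp add: \<rho>_def m_def z_def)
    show "q (fst (\<rho> (y, s))) = q y"
      using qG[OF z, of "L z - m z"] \<gamma>L[OF z] bounds[OF z] by (simp add: \<rho>_def z_def)
  qed
qed

section \<open>Pulling the fibration and the retraction back along f\<close>

text \<open>A lift to \<open>Y\<close> of the homotopy composed with \<open>f\<close>, paired with
  the homotopy itself, lands in the pullback.\<close>

lemma hurewicz_fibration_pullback_space:
  fixes Y :: "'y topology" and B :: "'b topology" and A :: "'a topology"
  assumes fib: "hurewicz_fibration TYPE('y \<times> (real \<Rightarrow> 'b)) Y B q"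
    and A: "kspace A" and f: "continuous_map A B f"
  shows "hurewicz_fibration TYPE('z) (pullback_space Y A q f) A snd"
  unfolding hurewicz_fibration_def
proof (intro conjI allI impI)
  let ?E = "pullback_space Y A q f" and ?I = unit_interval
  show "kspace ?E" by (rule kspace_pullback_space)
  show "kspace A" by fact
  show "continuous_map ?E A snd" by (rule continuous_map_pullback_space_proj)
  fix Z :: "'z topology" and h H
  assume *: "kspace Z \<and> continuous_map Z ?E h \<and> continuous_map (kprod Z ?I) A H \<and>
    (\<forall>z\<in>topspace Z. H (z, 0) = snd (h z))"
  then have Z: "kspace Z" and h: "continuous_map Z ?E h"
    and H: "continuous_map (prod_topology Z ?I) A H" and H0: "\<And>z. z \<in> topspace Z \<Longrightarrow> H (z, 0) = snd (h z)"
    by (auto simp: kprod_unit_interval)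
  have hE: "q (fst (h z)) = f (snd (h z))" if "z \<in> topspace Z" for z
    using continuous_map_image_subset_topspace[OF h] that by (auto simp: topspace_pullback_space)
  obtain G where G: "continuous_map (prod_topology Z ?I) Y G"
    "\<And>z. z \<in> topspace Z \<Longrightarrow> G (z, 0) = fst (h z)"
    "\<And>z s. z \<in> topspace Z \<Longrightarrow> s \<in> {0..1} \<Longrightarrow> q (G (z, s)) = f (H (z, s))"
    using hurewicz_fibration_lift[OF fib Z
        continuous_map_comp[OF h continuous_map_pullback_space_proj(1)] continuous_map_comp[OF H f]]
      hE H0 by auto
  have "continuous_map (kprod Z ?I) ?E (\<lambda>x. (G x, H x))"
    unfolding kprod_unit_interval[OF Z]
    using G H Z by (intro continuous_map_into_pullback_space kspace_prod_unit_interval) auto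
  then show "\<exists>G. continuous_map (kprod Z ?I) ?E G \<and> (\<forall>z\<in>topspace Z. G (z, 0) = h z) \<and>
      (\<forall>z\<in>topspace Z. \<forall>s\<in>{0..1}. snd (G (z, s)) = H (z, s))"
    using G(2) H0 by (intro exI[of _ "\<lambda>x. (G x, H x)"]) auto
qed

theorem theorem16:
  fixes A :: "'a topology" and B :: "'b topology" and Y :: "'y topology"
    and q :: "'y \<Rightarrow> 'b" and t :: "'b \<Rightarrow> 'y" and f :: "'a \<Rightarrow> 'b"
  assumes "kspace A" and "kspace B" and "kspace Y"
    and "weak_Hausdorff B"
    and "hurewicz_fibration TYPE('y \<times> (real \<Rightarrow> 'b)) Y B q"
    and "retraction_maps Y B q t"
    and "closed_cofibration TYPE('y + 'b \<times> real) B Y t"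
    and "continuous_map A B f"
  shows "hurewicz_fibration TYPE('z) (pullback_space Y A q f) A snd \<and>
         retraction_maps (pullback_space Y A q f) A snd (\<lambda>a. (t (f a), a)) \<and>
         closed_cofibration TYPE('w) A (pullback_space Y A q f) (\<lambda>a. (t (f a), a))"
proof (intro conjI)
  let ?E = "pullback_space Y A q f" and ?I = unit_interval and ?\<sigma> = "\<lambda>a. (t (f a), a)"
  note fib = assms(5) and ret = assms(6) and cof = assms(7) and f = assms(8)
  have t: "continuous_map B Y t" and qt: "\<And>b. b \<in> topspace B \<Longrightarrow> q (t b) = b"
    using ret by (auto simp: retraction_maps_def)
  have fB: "a \<in> topspace A \<Longrightarrow> f a \<in> topspace B" for a
    using f by (auto simp: continuous_map_def)
  have tY: "b \<in> topspace B \<Longrightarrow> t b \<in> topspace Y" for b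
    using t by (auto simp: continuous_map_def)
  show "hurewicz_fibration TYPE('z) ?E A snd"
    using fib assms(1) f by (rule hurewicz_fibration_pullback_space)
  show retE: "retraction_maps ?E A snd ?\<sigma>"
    unfolding retraction_maps_def
    using assms(1) continuous_map_comp[OF f t] fB qt
    by (auto intro!: continuous_map_into_pullback_space continuous_map_pullback_space_proj)
  obtain \<rho> where \<rho>: "continuous_map (prod_topology Y ?I) (prod_topology Y ?I) \<rho>"
    and \<rho>_0: "\<And>y. y \<in> topspace Y \<Longrightarrow> \<rho> (y, 0) = (y, 0)"
    and \<rho>_t: "\<And>b s. b \<in> topspace B \<Longrightarrow> s \<in> {0..1} \<Longrightarrow> \<rho> (t b, s) = (t b, s)"
    and \<rho>_M: "\<And>y s. y \<in> topspace Y \<Longrightarrow> s \<in> {0..1} \<Longrightarrow>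
      snd (\<rho> (y, s)) = 0 \<or> fst (\<rho> (y, s)) \<in> t ` topspace B"
    and \<rho>_q: "\<And>y s. y \<in> topspace Y \<Longrightarrow> s \<in> {0..1} \<Longrightarrow> q (fst (\<rho> (y, s))) = q y"
    using fibrewise_retraction[OF fib ret cof] by blast
  \<comment> \<open>If \<open>y = t b\<close>, then \<open>b = q y = f a\<close>, so
    \<open>y\<close> is the value of the section over \<open>a\<close>.\<close>
  have image_\<sigma>: "(y, a) \<in> ?\<sigma> ` topspace A \<longleftrightarrow> y \<in> t ` topspace B"
    if "a \<in> topspace A" "q y = f a" for y a
    using that fB qt by auto
  \<comment> \<open>The point of \<open>A\<close> is kept while \<open>\<rho>\<close> moves the
    rest; the result is again in the pullback because \<open>\<rho>\<close> preserves the fibres of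
    \<open>q\<close>.\<close>
  define R where "R = (\<lambda>x :: ('y \<times> 'a) \<times> real. ((fst (\<rho> (fst (fst x), snd x)), snd (fst x)), snd (\<rho> (fst (fst x), snd x))))"
  show "closed_cofibration TYPE('w) A ?E ?\<sigma>"
  proof (rule closed_cofibrationI_retraction[OF assms(1) kspace_pullback_space retE, where r = R])
    have "closedin ?E {x \<in> topspace ?E. fst x \<in> t ` topspace B}"
      using cof by (intro closedin_continuous_map_preimage[OF continuous_map_pullback_space_proj(1)])
        (simp add: closed_cofibration_def)
    also have "{x \<in> topspace ?E. fst x \<in> t ` topspace B} = ?\<sigma> ` topspace A"
      using fB qt tY by (auto simp: topspace_pullback_space)
    finally show "closedin ?E (?\<sigma> ` topspace A)" .
    have \<rho>E: "continuous_map (prod_topology ?E ?I) (prod_topology Y ?I) (\<lambda>x. \<rho> (fst (fst x), snd x))"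
      by (intro continuous_map_comp[OF _ \<rho>] continuous_map_pairedI continuous_map_snd
          continuous_map_comp[OF continuous_map_fst continuous_map_pullback_space_proj(1)])
    show "continuous_map (prod_topology ?E ?I) (prod_topology ?E ?I) R"
      unfolding R_def
    proof (intro continuous_map_pairedI continuous_map_into_pullback_space)
      show "kspace (prod_topology ?E ?I)"
        by (intro kspace_prod_unit_interval kspace_pullback_space)
      show "continuous_map (prod_topology ?E ?I) Y (\<lambda>x. fst (\<rho> (fst (fst x), snd x)))"
        by (rule continuous_map_comp[OF \<rho>E continuous_map_fst])
      show "continuous_map (prod_topology ?E ?I) ?I (\<lambda>x. snd (\<rho> (fst (fst x), snd x)))"
        by (rule continuous_map_comp[OF \<rho>E continuous_map_snd])
      show "continuous_map (prod_topology ?E ?I) A (\<lambda>x. snd (fst x))"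
        by (rule continuous_map_comp[OF continuous_map_fst continuous_map_pullback_space_proj(2)])
      show "q (fst (\<rho> (fst (fst x), snd x))) = f (snd (fst x))" if "x \<in> topspace (prod_topology ?E ?I)" for x
        using that \<rho>_q by (auto simp: topspace_pullback_space)
    qed
    show "R (x, 0) = (x, 0)" if "x \<in> topspace ?E" for x
      using that \<rho>_0 by (auto simp: R_def topspace_pullback_space)
    show "R (?\<sigma> a, s) = (?\<sigma> a, s)" if "a \<in> topspace A" "s \<in> {0..1}" for a s
      using that \<rho>_t fB by (simp add: R_def)
    show "snd (R (x, s)) = 0 \<or> fst (R (x, s)) \<in> ?\<sigma> ` topspace A"
      if x: "x \<in> topspace ?E" and s: "s \<in> {0..1}" for x s
    proof -
      obtain y a where ya: "x = (y, a)" "y \<in> topspace Y" "a \<in> topspace A" "q y = f a"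
        using x by (auto simp: topspace_pullback_space)
      then show ?thesis
        using \<rho>_M[OF ya(2) s] \<rho>_q[OF ya(2) s] image_\<sigma> by (auto simp: R_def)
    qed
  qed
qed

end
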